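(* Let $C$ be the set of numbers $\lambda_0(a)$, where $\theta=(\theta_1,\theta_2,\dots)$ ranges over $\{1,2\}^{\mathbb{N}}$ and $a=a(\theta)=(a_n)_{n\in\mathbb{Z}}$ is the sequence written $\overline{3322212}\,3\,3^*\,2221233222122121212\,\theta$, i.e.: $a_0=a_{-1}=3$; $(a_{-8},a_{-7},\dots,a_{-2})=(3,3,2,2,2,1,2)$ and $a_{n-7}=a_n$ for all $n\le -2$; $(a_1,\dots,a_{19})=(2,2,2,1,2,3,3,2,2,2,1,2,2,1,2,1,2,1,2)$; and $a_{19+k}=\theta_k$ for $k\ge1$. Then $C\subset M\setminus L$.
   Context: For a bi-infinite sequence $a=(a_n)_{n\in\mathbb{Z}}$ of positive integers, $\lambda_i(a)=[a_i;a_{i+1},a_{i+2},\dots]+[0;a_{i-1},a_{i-2},\dots]$ (regular continued fractions), the Markov value is $m(a)=\sup_{n\in\mathbb{Z}}\lambda_n(a)$ and the Lagrange value is $\ell(a)=\limsup_{n\to+\infty}\lambda_n(a)$. The Markov spectrum $M$ (resp. Lagrange spectrum $L$) is the set of finite Markov (resp. Lagrange) values. *)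

theory Defs
  imports "HOL-Analysis.Analysis"
begin

text \<open>The finite continued fraction \<open>[c\<^sub>0; c\<^sub>1, \<dots>, c\<^sub>n]\<close> and its limit \<open>[c\<^sub>0; c\<^sub>1, c\<^sub>2, \<dots>]\<close>. The limit
  exists whenever \<open>c\<^sub>1, c\<^sub>2, \<dots>\<close> are positive; \<open>c\<^sub>0 = 0\<close> is allowed.\<close>

fun cf_fin :: "nat \<Rightarrow> (nat \<Rightarrow> nat) \<Rightarrow> real" where
  "cf_fin 0 c = real (c 0)"
| "cf_fin (Suc n) c = real (c 0) + 1 / cf_fin n (\<lambda>k. c (Suc k))"

definition cf :: "(nat \<Rightarrow> nat) \<Rightarrow> real" where
  "cf c = lim (\<lambda>n. cf_fin n c)"

definition markov_lambda :: "(int \<Rightarrow> nat) \<Rightarrow> int \<Rightarrow> real" where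
  "markov_lambda a i =
     cf (\<lambda>k. a (i + int k)) + cf (\<lambda>k. if k = 0 then 0 else a (i - int k))"

text \<open>Supremum and limit superior are taken in the extended reals, so that infinite values
  are represented as such; the spectra collect the finite ones.\<close>

definition markov_value :: "(int \<Rightarrow> nat) \<Rightarrow> ereal" where
  "markov_value a = (SUP n. ereal (markov_lambda a n))"

definition lagrange_value :: "(int \<Rightarrow> nat) \<Rightarrow> ereal" where
  "lagrange_value a = limsup (\<lambda>n. ereal (markov_lambda a (int n)))"

definition markov_spectrum :: "real set" where
  "markov_spectrum = {x. \<exists>a. (\<forall>n. a n > 0) \<and> markov_value a = ereal x}"

definition lagrange_spectrum :: "real set" where
  "lagrange_spectrum = {x. \<exists>a. (\<forall>n. a n > 0) \<and> lagrange_value a = ereal x}"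

text \<open>The sequence \<open>\<theta>\<^sub>1, \<theta>\<^sub>2, \<dots>\<close> is indexed from 1; the value \<open>\<theta> 0\<close> is never used. Since
  \<open>mod\<close> on integers is nonnegative for a positive modulus, the first branch is the leftward
  periodic extension of \<open>(a\<^bsub>-8\<^esub>, \<dots>, a\<^bsub>-2\<^esub>) = (3, 3, 2, 2, 2, 1, 2)\<close>.\<close>

definition a_seq :: "(nat \<Rightarrow> nat) \<Rightarrow> int \<Rightarrow> nat" where
  "a_seq \<theta> n =
     (if n \<le> -2 then [3, 3, 2, 2, 2, 1, 2] ! nat ((n + 8) mod 7)
      else if n \<le> 0 then 3
      else if n \<le> 19 then
        [2, 2, 2, 1, 2, 3, 3, 2, 2, 2, 1, 2, 2, 1, 2, 1, 2, 1, 2] ! nat (n - 1)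
      else \<theta> (nat (n - 19)))"

definition C_set :: "real set" where
  "C_set = {markov_lambda (a_seq \<theta>) 0 | \<theta>. \<forall>k\<ge>1. \<theta> k \<in> {1, 2}}"

end

theory Submission
  imports Defs
begin

text \<open>Both statements reduce to finitely many comparisons of continued fractions, because the
  values in \<open>C\<close> lie in the tiny interval between \<open>gap_lo\<close> and \<open>gap_hi\<close>. All \<open>\<lambda>\<^sub>n\<close> of \<open>a(\<theta>)\<close> with
  \<open>n \<noteq> 0\<close> are at most \<open>gap_lo\<close>, hence \<open>C \<subseteq> M\<close>. Now let \<open>\<lambda>\<^sub>n < gap_hi\<close> hold near a position
  \<open>n\<close> of some sequence. If also \<open>\<lambda>\<^sub>n > gap_lo\<close>, then the word
  \<open>332221233222123 3\<^sup>* 2221233222122\<close> or its mirror image stands at \<open>n\<close> (local uniqueness). This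
  word without its last letter reproduces itself seven places further to the left
  (self-replication). So if a Lagrange value lay in \<open>C\<close>, two far out occurrences of the word
  with the same orientation would exist, and the period spreading from one of them would overwrite
  the last letter of the other.\<close>

abbreviation gap_lo :: real where "gap_lo \<equiv> 370969985975 / 100000000000"

abbreviation gap_hi :: real where "gap_hi \<equiv> 37096998597503 / 10000000000000"

section \<open>Continued fractions with positive digits\<close>

lemma cf_fin_bounds:
  assumes "\<And>k. k \<ge> 1 \<Longrightarrow> c k \<ge> 1"
  shows "real (c 0) \<le> cf_fin n c \<and> cf_fin n c \<le> real (c 0) + 1"
  using assms
proof (induction n arbitrary: c)
  case (Suc n)
  have "cf_fin n (\<lambda>k. c (Suc k)) \<ge> real (c (Suc 0))"
    using Suc.IH[of "\<lambda>k. c (Suc k)"] Suc.prems by simp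
  moreover have "real (c (Suc 0)) \<ge> 1" using Suc.prems[of 1] by simp
  ultimately have "cf_fin n (\<lambda>k. c (Suc k)) \<ge> 1" by linarith
  then show ?case by simp
qed simp

text \<open>The difference of the reciprocals is \<open>(x - y) / ((u * x) * (v * y))\<close> with
  \<open>u * x = c * x + 1 \<ge> 2\<close>, and likewise for \<open>v * y\<close>. So two continued
  fraction steps contract distances by a factor 4.\<close>

lemma inverse_step_contraction:
  fixes x y u v :: real
  assumes "x \<ge> 1" "y \<ge> 1" "u = c + 1 / x" "v = c + 1 / y" "c \<ge> 1"
  shows "\<bar>1 / u - 1 / v\<bar> \<le> \<bar>x - y\<bar> / 4"
proof -
  have ux: "u * x \<ge> 2" and vy: "v * y \<ge> 2"
    using assms mult_mono[of 1 c 1 x] mult_mono[of 1 c 1 y] by (auto simp: distrib_right)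
  have pos: "u > 0" "v > 0" using assms by (auto intro: add_pos_nonneg)
  have "1 / u - 1 / v = (x - y) / ((u * x) * (v * y))"
  proof -
    have "v - u = (x - y) / (x * y)" unfolding assms(3,4) using assms(1,2) by (simp add: field_simps)
    moreover have "1 / u - 1 / v = (v - u) / (u * v)" using pos by (simp add: field_simps)
    ultimately show ?thesis by (simp add: mult_ac)
  qed
  moreover have D: "4 \<le> (u * x) * (v * y)" using mult_mono[OF ux vy] ux by linarith
  then have "\<bar>x - y\<bar> / ((u * x) * (v * y)) \<le> \<bar>x - y\<bar> / 4"
    by (intro divide_left_mono) auto
  ultimately show ?thesis using D by (simp add: abs_divide del: abs_mult)
qed

text \<open>Two shared digits are peeled off \<open>j\<close> times, each time gaining a factor 4;
  at \<open>j = 0\<close> both fractions lie in an interval of length 1. This gives the Cauchy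
  property.\<close>

lemma cf_fin_dist:
  assumes "\<And>k. k \<ge> 1 \<Longrightarrow> c k \<ge> 1" "2 * j \<le> n" "2 * j \<le> m"
  shows "\<bar>cf_fin n c - cf_fin m c\<bar> \<le> (1 / 4) ^ j"
  using assms
proof (induction j arbitrary: c n m)
  case 0
  then show ?case using cf_fin_bounds[of c n] cf_fin_bounds[of c m] by (auto simp: abs_if)
next
  case (Suc j)
  obtain n' m' where nm: "n = Suc (Suc n')" "m = Suc (Suc m')"
    using Suc.prems(2,3) by (cases n; cases "n - 1"; cases m; cases "m - 1") auto
  define d where "d = (\<lambda>k. c (Suc (Suc k)))"
  have c1: "real (c 1) \<ge> 1" and d0: "real (d 0) \<ge> 1"
    using Suc.prems(1)[of 1] Suc.prems(1)[of 2] by (auto simp: d_def numeral_2_eq_2)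
  have d: "\<And>k. k \<ge> 1 \<Longrightarrow> d k \<ge> 1" using Suc.prems(1) by (simp add: d_def)
  have ge: "cf_fin i d \<ge> 1" for i using cf_fin_bounds[of d i] d d0 by fastforce
  have "\<bar>cf_fin n c - cf_fin m c\<bar> \<le> \<bar>cf_fin n' d - cf_fin m' d\<bar> / 4"
    using inverse_step_contraction[OF ge[of n'] ge[of m'] refl refl c1] by (simp add: nm d_def)
  also have "\<dots> \<le> (1 / 4) ^ Suc j"
    using Suc.IH[of d n' m'] d Suc.prems(2,3) by (simp add: nm)
  finally show ?case .
qed

lemma cf_fin_convergent:
  assumes "\<And>k. k \<ge> 1 \<Longrightarrow> c k \<ge> 1"
  shows "(\<lambda>n. cf_fin n c) \<longlonglongrightarrow> cf c"
proof -
  have "Cauchy (\<lambda>n. cf_fin n c)"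
  proof (rule metric_CauchyI)
    fix e :: real assume "e > 0"
    then obtain j where "(1 / 4) ^ j < e"
      using real_arch_pow_inv[of e "1/4"] by auto
    moreover have "dist (cf_fin m c) (cf_fin n c) \<le> (1 / 4) ^ j" if "m \<ge> 2 * j" "n \<ge> 2 * j" for m n
      using cf_fin_dist[where c = c and j = j] assms that by (simp add: dist_real_def)
    ultimately show "\<exists>M. \<forall>m\<ge>M. \<forall>n\<ge>M. dist (cf_fin m c) (cf_fin n c) < e"
      by (meson le_less_trans)
  qed
  then show ?thesis
    unfolding cf_def using Cauchy_convergent convergent_LIMSEQ_iff by blast
qed


text \<open>Passage to the limit in the recursion of \<open>cf_fin\<close>; the tail limit is at
  least \<open>c 1\<close>, hence nonzero. Positivity is asked from index 1 on, so that the half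
  \<open>[0; ...]\<close> of a Markov sum is covered.\<close>

lemma cf_rec:
  assumes "\<And>k. k \<ge> 1 \<Longrightarrow> c k \<ge> 1"
  shows "cf c = real (c 0) + 1 / cf (\<lambda>k. c (Suc k))"
    and "cf (\<lambda>k. c (Suc k)) \<ge> real (c 1)"
    and "cf c \<ge> real (c 0)"
proof -
  let ?d = "\<lambda>k. c (Suc k)"
  have d: "\<And>k. k \<ge> 1 \<Longrightarrow> ?d k \<ge> 1" using assms by simp
  have lim_d: "(\<lambda>n. cf_fin n ?d) \<longlonglongrightarrow> cf ?d" by (rule cf_fin_convergent) (rule d)
  show ge: "cf ?d \<ge> real (c 1)"
    by (rule LIMSEQ_le_const[OF lim_d]) (use cf_fin_bounds[of ?d] d in auto)
  have "c 1 \<ge> 1" using assms by simp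
  with ge have "cf ?d \<noteq> 0" by linarith
  have "(\<lambda>n. cf_fin (Suc n) c) \<longlonglongrightarrow> real (c 0) + 1 / cf ?d"
    by (simp, intro tendsto_intros lim_d) fact
  moreover have lim_c: "(\<lambda>n. cf_fin n c) \<longlonglongrightarrow> cf c" using assms by (rule cf_fin_convergent)
  then have "(\<lambda>n. cf_fin (Suc n) c) \<longlonglongrightarrow> cf c" by (rule LIMSEQ_Suc)
  ultimately show "cf c = real (c 0) + 1 / cf ?d" using LIMSEQ_unique by blast
  show "cf c \<ge> real (c 0)"
    by (rule LIMSEQ_le_const[OF lim_c]) (use cf_fin_bounds[of c] assms in auto)
qed

section \<open>Right and left continued fractions of a bi-infinite sequence\<close>

definition rcf :: "(int \<Rightarrow> nat) \<Rightarrow> int \<Rightarrow> real" where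
  "rcf a i = cf (\<lambda>k. a (i + int k))"

text \<open>The digit at \<open>i\<close> is included, so the left summand of
  \<open>\<lambda>\<^sub>i\<close> is \<open>1 / lcf a (i - 1)\<close>.\<close>

definition lcf :: "(int \<Rightarrow> nat) \<Rightarrow> int \<Rightarrow> real" where
  "lcf a i = cf (\<lambda>k. a (i - int k))"

context
  fixes a :: "int \<Rightarrow> nat"
  assumes pos: "\<forall>n. a n > 0"
begin

lemma pos1: "a n \<ge> 1"
  using pos by (simp add: Suc_leI)

lemma rcf_rec: "rcf a i = real (a i) + 1 / rcf a (i + 1)"
  using cf_rec(1)[of "\<lambda>k. a (i + int k)"] pos1 by (simp add: rcf_def add_ac)

lemma lcf_rec: "lcf a i = real (a i) + 1 / lcf a (i - 1)"
  using cf_rec(1)[of "\<lambda>k. a (i - int k)"] pos1 by (simp add: lcf_def diff_diff_eq)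

lemma rcf_ge: "rcf a i \<ge> real (a i)"
  using cf_rec(3)[of "\<lambda>k. a (i + int k)"] pos1 by (simp add: rcf_def)

lemma lcf_ge: "lcf a i \<ge> real (a i)"
  using cf_rec(3)[of "\<lambda>k. a (i - int k)"] pos1 by (simp add: lcf_def)

lemma markov_lambda_eq: "markov_lambda a i = rcf a i + 1 / lcf a (i - 1)"
proof -
  have "cf (\<lambda>k. if k = 0 then 0 else a (i - int k)) = 1 / lcf a (i - 1)"
    using cf_rec(1)[of "\<lambda>k. if k = 0 then 0 else a (i - int k)"] pos1
    by (simp add: lcf_def diff_diff_eq)
  then show ?thesis by (simp add: markov_lambda_def rcf_def)
qed

lemma digit_less_markov_lambda: "real (a i) < markov_lambda a i"
proof -
  have "lcf a (i - 1) > 0" using lcf_ge[of "i - 1"] pos1[of "i - 1"] by linarith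
  then have "1 / lcf a (i - 1) > 0" by simp
  with rcf_ge[of i] show ?thesis unfolding markov_lambda_eq by linarith
qed

end

lemma quotient_step:
  fixes x y l u :: real
  assumes "x = d + 1 / y" "l \<le> y" "y \<le> u" "0 < l" "1 \<le> d" "d \<le> 3"
  shows "1 + 1 / u \<le> x" "x \<le> 3 + 1 / l"
proof -
  have "1 / u \<le> 1 / y" "1 / y \<le> 1 / l" using assms by (auto intro!: divide_left_mono)
  then show "1 + 1 / u \<le> x" "x \<le> 3 + 1 / l" using assms by auto
qed

text \<open>The interval \<open>[63/50, 19/5]\<close> is mapped into itself by \<open>x \<mapsto> d + 1/x\<close> for \<open>1 \<le> d \<le> 3\<close>, and
  three such steps lead from \<open>[1, 4]\<close> into it.\<close>

lemma quotient_bounds: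
  fixes f :: "nat \<Rightarrow> real"
  assumes rec: "\<And>k. f k = d k + 1 / f (Suc k)" and ge: "\<And>k. f k \<ge> 1"
    and d: "\<And>k. k \<le> 3 \<Longrightarrow> 1 \<le> d k \<and> d k \<le> 3"
  shows "63 / 50 \<le> f 0 \<and> f 0 \<le> 19 / 5"
proof -
  have "1 / f 4 \<le> 1" using ge[of 4] by simp
  then have 3: "f 3 \<le> 4" using rec[of 3] d[of 3] by simp
  have 2: "5 / 4 \<le> f 2" "f 2 \<le> 4"
    using quotient_step[of "f 2" "d 2" "f 3" 1 4] rec[of 2] ge[of 3] 3 d[of 2]
    by (auto simp: eval_nat_numeral)
  have 1: "5 / 4 \<le> f 1" "f 1 \<le> 19 / 5"
    using quotient_step[of "f 1" "d 1" "f 2" "5 / 4" 4] rec[of 1] 2 d[of 1]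
    by (auto simp: eval_nat_numeral)
  show ?thesis
    using quotient_step[of "f 0" "d 0" "f 1" "5 / 4" "19 / 5"] rec[of 0] 1 d[of 0] by auto
qed

section \<open>Words and certified case distinctions\<close>

definition occ :: "(int \<Rightarrow> int) \<Rightarrow> int \<Rightarrow> int list \<Rightarrow> bool" where
  "occ b p w \<longleftrightarrow> (\<forall>k<length w. b (p + int k) = w ! k)"

lemma occ_Nil [simp]: "occ b p []"
  by (simp add: occ_def)

lemma occ_Cons [simp]: "occ b p (x # w) \<longleftrightarrow> b p = x \<and> occ b (p + 1) w"
  by (auto simp: occ_def All_less_Suc2 add_ac)

lemma occ_append [simp]: "occ b p (v @ w) \<longleftrightarrow> occ b p v \<and> occ b (p + int (length v)) w"
  by (induction v arbitrary: p) (auto simp: add_ac)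

lemma occ_take: "occ b p w \<Longrightarrow> occ b p (take r w)"
  by (simp add: occ_def)

lemma occ_drop: "occ b p w \<Longrightarrow> occ b (p + int i) (drop i w)"
  by (auto simp: occ_def add.assoc simp flip: of_nat_add)

lemma occ_rev: "occ b p w \<Longrightarrow> occ (\<lambda>i. b (- i)) (1 - p - int (length w)) (rev w)"
proof (induction w arbitrary: p)
  case (Cons x w)
  then show ?case using Cons.IH[of "p + 1"] by (simp add: algebra_simps)
qed simp

text \<open>\<open>cf_bound up w\<close> is the fraction \<open>[w\<^sub>0; w\<^sub>1, \<dots>, t]\<close> as a pair, where the tail \<open>t\<close> is
  the endpoint of \<open>[63/50, 19/5]\<close> that makes it an upper (\<open>up\<close>) or lower bound.\<close>

fun cf_bound :: "bool \<Rightarrow> int list \<Rightarrow> int \<times> int" where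
  "cf_bound up [] = (if up then (19, 5) else (63, 50))"
| "cf_bound up (x # w) = (case cf_bound (\<not> up) w of (p, q) \<Rightarrow> (x * p + q, p))"

text \<open>Denominator-free form of \<open>n/d \<le> p/q + q'/p'\<close>, where \<open>p/q\<close>
  bounds the right half \<open>v\<close> from below and \<open>p'/q'\<close> bounds the left half
  \<open>u\<close>, read leftwards, from above.\<close>

definition lambda_ge :: "int \<Rightarrow> int \<Rightarrow> int list \<Rightarrow> int list \<Rightarrow> bool" where
  "lambda_ge n d u v =
    (case cf_bound False v of (p, q) \<Rightarrow> case cf_bound True u of (p', q') \<Rightarrow>
      n * (q * p') \<le> d * (p * p' + q' * q))"

definition lambda_le :: "int \<Rightarrow> int \<Rightarrow> int list \<Rightarrow> int list \<Rightarrow> bool" where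
  "lambda_le n d u v =
    (case cf_bound True v of (p, q) \<Rightarrow> case cf_bound False u of (p', q') \<Rightarrow>
      d * (p * p' + q' * q) \<le> n * (q * p'))"

text \<open>The range is finite because a Lagrange value controls digits only far to the right.
  \<open>R\<close> and \<open>L\<close> are abstract so that reflection
  \<open>i \<mapsto> -i\<close> can exchange them.\<close>

locale cf_window =
  fixes b :: "int \<Rightarrow> int" and R L :: "int \<Rightarrow> real" and lo hi :: int
  assumes digit: "lo \<le> i \<Longrightarrow> i \<le> hi \<Longrightarrow> b i \<in> {1, 2, 3}"
    and R_rec: "lo \<le> i \<Longrightarrow> i \<le> hi \<Longrightarrow> R i = b i + 1 / R (i + 1)"
    and L_rec: "lo \<le> i \<Longrightarrow> i \<le> hi \<Longrightarrow> L i = b i + 1 / L (i - 1)"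
    and R_bounds: "lo \<le> i \<Longrightarrow> i \<le> hi \<Longrightarrow> 63 / 50 \<le> R i \<and> R i \<le> 19 / 5"
    and L_bounds: "lo \<le> i \<Longrightarrow> i \<le> hi \<Longrightarrow> 63 / 50 \<le> L i \<and> L i \<le> 19 / 5"
begin

lemma reflect: "cf_window (\<lambda>i. b (- i)) (\<lambda>i. L (- i)) (\<lambda>i. R (- i)) (- hi) (- lo)"
proof
  fix i :: int
  assume i: "- hi \<le> i" "i \<le> - lo"
  show "b (- i) \<in> {1, 2, 3}" using digit[of "- i"] i by simp
  show "L (- i) = b (- i) + 1 / L (- (i + 1))" using L_rec[of "- i"] i by simp
  show "R (- i) = b (- i) + 1 / R (- (i - 1))" using R_rec[of "- i"] i by simp
  show "63 / 50 \<le> L (- i) \<and> L (- i) \<le> 19 / 5" using L_bounds[of "- i"] i by simp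
  show "63 / 50 \<le> R (- i) \<and> R (- i) \<le> 19 / 5" using R_bounds[of "- i"] i by simp
qed

text \<open>Taking reciprocals reverses order, so \<open>up\<close> flips at each letter; after the
  last letter the tail is estimated by \<open>R_bounds\<close>.\<close>

lemma R_cf_bound:
  assumes "occ b p w" "lo \<le> p" "p + int (length w) \<le> hi" "cf_bound up w = (P, Q)"
  shows "P > 0 \<and> Q > 0 \<and> (if up then R p \<le> P / Q else P / Q \<le> R p)"
  using assms
proof (induction w arbitrary: p up P Q)
  case Nil
  then show ?case using R_bounds[of p] by (auto split: if_splits)
next
  case (Cons x w)
  obtain P' Q' where b': "cf_bound (\<not> up) w = (P', Q')" by fastforce
  have IH: "P' > 0 \<and> Q' > 0 \<and> (if \<not> up then R (p + 1) \<le> P' / Q' else P' / Q' \<le> R (p + 1))"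
    using Cons.IH[of "p + 1"] Cons.prems b' by simp
  have x: "R p = x + 1 / R (p + 1)" "x > 0"
    using R_rec[of p] digit[of p] Cons.prems by auto
  have PQ: "P = x * P' + Q'" "Q = P'" using Cons.prems b' by auto
  have Rp: "R (p + 1) > 0" using R_bounds[of "p + 1"] Cons.prems by auto
  have eq: "real_of_int P / real_of_int Q = x + 1 / (P' / Q')" using IH by (simp add: PQ field_simps)
  have "P > 0" "Q > 0" using IH x by (auto simp: PQ intro!: add_pos_pos)
  moreover have "if up then R p \<le> P / Q else P / Q \<le> R p"
  proof (cases up)
    case True
    then have "1 / R (p + 1) \<le> 1 / (P' / Q')" using IH Rp by (intro divide_left_mono) auto
    then show ?thesis using True by (simp only: eq x(1) if_True add_left_mono)
  next
    case False
    then have "1 / (P' / Q') \<le> 1 / R (p + 1)" using IH Rp by (intro divide_left_mono) auto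
    then show ?thesis using False by (simp only: eq x(1) if_False add_left_mono)
  qed
  ultimately show ?case by blast
qed

text \<open>This is \<open>R_cf_bound\<close> in the reflected window, for at most \<open>l\<close>
  letters before letter \<open>i\<close>, read backwards.\<close>

lemma L_cf_bound:
  assumes "occ b p w" "lo \<le> p - 1" "p + int (length w) \<le> hi" "i \<le> length w"
    "cf_bound up (take l (rev (take i w))) = (P, Q)"
  shows "P > 0 \<and> Q > 0 \<and> (if up then L (p + int i - 1) \<le> P / Q else P / Q \<le> L (p + int i - 1))"
proof -
  interpret refl: cf_window "\<lambda>i. b (- i)" "\<lambda>i. L (- i)" "\<lambda>i. R (- i)" "- hi" "- lo"
    by (rule reflect)
  have "occ (\<lambda>i. b (- i)) (1 - p - int i) (take l (rev (take i w)))"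
    using occ_take[OF occ_rev[OF occ_take[OF assms(1), of i]], of l] assms(4) by (simp add: min_absorb2)
  moreover have "- hi \<le> 1 - p - int i" using assms by simp
  moreover have "1 - p - int i + int (length (take l (rev (take i w)))) \<le> - lo" using assms by simp
  moreover have "- (1 - p - int i) = p + int i - 1" by simp
  ultimately show ?thesis using refl.R_cf_bound[OF _ _ _ assms(5)] by metis
qed

lemma lambda_geD:
  assumes "occ b p w" "lo \<le> p - 1" "p + int (length w) \<le> hi" "i < length w"
    "lambda_ge n d (take l (rev (take i w))) (take r (drop i w))" "d > 0"
  shows "n / d \<le> R (p + int i) + 1 / L (p + int i - 1)"
proof -
  obtain P Q P' Q' where PQ: "cf_bound False (take r (drop i w)) = (P, Q)"
    "cf_bound True (take l (rev (take i w))) = (P', Q')" by fastforce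
  have R: "P > 0 \<and> Q > 0 \<and> P / Q \<le> R (p + int i)"
    using R_cf_bound[OF occ_take[OF occ_drop[OF assms(1)]] _ _ PQ(1)] assms by simp
  have L: "P' > 0 \<and> Q' > 0 \<and> L (p + int i - 1) \<le> P' / Q'"
    using L_cf_bound[OF assms(1) _ _ _ PQ(2)] assms by simp
  have "n * (Q * P') \<le> d * (P * P' + Q' * Q)" using assms(5) PQ by (simp add: lambda_ge_def)
  then have "real_of_int n * (Q * P') \<le> d * (P * P' + Q' * Q)"
    unfolding of_int_mult[symmetric] of_int_add[symmetric] of_int_le_iff .
  then have "n / d \<le> P / Q + 1 / (P' / Q')" using R L assms(6) by (simp add: field_simps)
  also have "1 / (P' / Q') \<le> 1 / L (p + int i - 1)"
    using L L_bounds[of "p + int i - 1"] assms by (intro divide_left_mono) auto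
  finally show ?thesis using R by linarith
qed

lemma lambda_leD:
  assumes "occ b p w" "lo \<le> p - 1" "p + int (length w) \<le> hi" "i < length w"
    "lambda_le n d (take l (rev (take i w))) (take r (drop i w))" "d > 0"
  shows "R (p + int i) + 1 / L (p + int i - 1) \<le> n / d"
proof -
  obtain P Q P' Q' where PQ: "cf_bound True (take r (drop i w)) = (P, Q)"
    "cf_bound False (take l (rev (take i w))) = (P', Q')" by fastforce
  have R: "P > 0 \<and> Q > 0 \<and> R (p + int i) \<le> P / Q"
    using R_cf_bound[OF occ_take[OF occ_drop[OF assms(1)]] _ _ PQ(1)] assms by simp
  have L: "P' > 0 \<and> Q' > 0 \<and> P' / Q' \<le> L (p + int i - 1)"
    using L_cf_bound[OF assms(1) _ _ _ PQ(2)] assms by simp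
  have "1 / L (p + int i - 1) \<le> 1 / (P' / Q')"
    using L L_bounds[of "p + int i - 1"] assms by (intro divide_left_mono) auto
  moreover have "d * (P * P' + Q' * Q) \<le> n * (Q * P')" using assms(5) PQ by (simp add: lambda_le_def)
  then have "real_of_int d * (P * P' + Q' * Q) \<le> n * (Q * P')"
    unfolding of_int_mult[symmetric] of_int_add[symmetric] of_int_le_iff .
  then have "P / Q + 1 / (P' / Q') \<le> n / d" using R L assms(6) by (simp add: field_simps)
  ultimately show ?thesis using R by linarith
qed

end

text \<open>A certificate is the tree of a case distinction over two-sided extensions of a word \<open>w\<close>
  whose letter number \<open>j\<close> is at the position under study. Branches end when a target word has
  appeared (\<open>Hit\<close>), when the value at letter \<open>i\<close> is too large (\<open>Big i l r\<close>, seen from the \<open>l\<close>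
  letters before and the \<open>r\<close> letters from \<open>i\<close> on), or when the value at letter \<open>j\<close> is too small
  (\<open>Small l r\<close>).\<close>

datatype cert = Hit | Big nat nat nat | Small nat nat | ExtL cert cert cert | ExtR cert cert cert

text \<open>A target \<open>(d, v)\<close> asks for \<open>v\<close> starting \<open>d\<close>
  places left of the centre. The flag \<open>sm\<close> admits \<open>Small\<close> leaves, for a
  centre value known to exceed \<open>gap_lo\<close>. The limit 40 on each side keeps every word
  inside the margin 50 of \<open>check_sound\<close>.\<close>

fun check :: "bool \<Rightarrow> (nat \<times> int list) list \<Rightarrow> cert \<Rightarrow> nat \<Rightarrow> int list \<Rightarrow> bool" where
  "check sm tg Hit j w = (\<exists>(d, v) \<in> set tg. d \<le> j \<and> take (length v) (drop (j - d) w) = v)"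
| "check sm tg (Big i l r) j w =
    (i < length w \<and>
     lambda_ge 37096998597503 10000000000000 (take l (rev (take i w))) (take r (drop i w)))"
| "check sm tg (Small l r) j w =
    (sm \<and> j < length w \<and>
     lambda_le 370969985975 100000000000 (take l (rev (take j w))) (take r (drop j w)))"
| "check sm tg (ExtL t1 t2 t3) j w =
    (j < 40 \<and> check sm tg t1 (Suc j) (1 # w) \<and> check sm tg t2 (Suc j) (2 # w) \<and>
     check sm tg t3 (Suc j) (3 # w))"
| "check sm tg (ExtR t1 t2 t3) j w =
    (length w < j + 40 \<and> check sm tg t1 j (w @ [1]) \<and> check sm tg t2 j (w @ [2]) \<and>
     check sm tg t3 j (w @ [3]))"

section \<open>Soundness of certificates where all values stay below \<open>gap_hi\<close>\<close>

locale low_window = cf_window +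
  assumes low: "lo < i \<Longrightarrow> i < hi \<Longrightarrow> R i + 1 / L (i - 1) < gap_hi"
begin

lemma reflect_lambda:
  assumes "lo \<le> n" "n \<le> hi"
  shows "L n + 1 / R (n + 1) = R n + 1 / L (n - 1)"
  using R_rec[of n] L_rec[of n] assms by simp

lemma reflect_low: "low_window (\<lambda>i. b (- i)) (\<lambda>i. L (- i)) (\<lambda>i. R (- i)) (- hi) (- lo)"
proof -
  interpret refl: cf_window "\<lambda>i. b (- i)" "\<lambda>i. L (- i)" "\<lambda>i. R (- i)" "- hi" "- lo"
    by (rule reflect)
  show ?thesis
  proof
    fix i :: int
    assume "- hi < i" "i < - lo"
    then show "L (- i) + 1 / R (- (i - 1)) < gap_hi"
      using low[of "- i"] reflect_lambda[of "- i"] by (simp add: algebra_simps)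
  qed
qed

text \<open>The actual digits of \<open>b\<close> select one branch of the tree. It cannot end in
  \<open>Big\<close> or \<open>Small\<close>, which contradict \<open>low\<close> and the lower
  bound at \<open>n\<close>, so it ends in \<open>Hit\<close>.\<close>

lemma check_sound:
  assumes "check sm tg t j w" "occ b (n - int j) w" "j \<le> 40" "length w \<le> j + 40"
    and "lo + 50 \<le> n" "n + 50 \<le> hi"
    and "sm \<Longrightarrow> gap_lo < R n + 1 / L (n - 1)"
  shows "\<exists>(d, v) \<in> set tg. occ b (n - int d) v"
  using assms(1-4)
proof (induction t arbitrary: j w)
  case Hit
  then obtain d v where v: "(d, v) \<in> set tg" "d \<le> j" "take (length v) (drop (j - d) w) = v"
    by auto
  have "occ b (n - int j + int (j - d)) (take (length v) (drop (j - d) w))"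
    using occ_take[OF occ_drop[OF Hit.prems(2)]] .
  then have "occ b (n - int d) v" using v by (simp add: of_nat_diff)
  then show ?case using v(1) by blast
next
  case (Big i l r)
  then have "gap_hi \<le> R (n - int j + int i) + 1 / L (n - int j + int i - 1)"
    using lambda_geD[OF Big.prems(2), of i 37096998597503 10000000000000 l r] assms(5,6) by auto
  moreover have "R (n - int j + int i) + 1 / L (n - int j + int i - 1) < gap_hi"
    using low[of "n - int j + int i"] Big.prems assms(5,6) by auto
  ultimately show ?case by linarith
next
  case (Small l r)
  then have "R n + 1 / L (n - 1) \<le> gap_lo"
    using lambda_leD[OF Small.prems(2), of j 370969985975 100000000000 l r] assms(5,6) by auto
  then show ?case using Small.prems(1) assms(7) by auto
next
  case (ExtL t1 t2 t3)
  have "occ b (n - int (Suc j)) (b (n - int (Suc j)) # w)"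
    using ExtL.prems(2) by (simp add: algebra_simps)
  moreover have "b (n - int (Suc j)) \<in> {1, 2, 3}"
    using digit[of "n - int (Suc j)"] ExtL.prems assms(5,6) by auto
  ultimately show ?case
    using ExtL.IH[of "Suc j" "b (n - int (Suc j)) # w"] ExtL.prems by auto
next
  case (ExtR t1 t2 t3)
  let ?x = "b (n - int j + int (length w))"
  have "occ b (n - int j) (w @ [?x])" using ExtR.prems(2) by simp
  moreover have "?x \<in> {1, 2, 3}"
    using digit[of "n - int j + int (length w)"] ExtR.prems assms(5,6) by auto
  ultimately show ?case
    using ExtR.IH[of j "w @ [?x]"] ExtR.prems by auto
qed

end

section \<open>Local uniqueness and self-replication\<close>

definition periodic_word :: "int list" where
  "periodic_word = [3,3,2,2,2,1,2, 3,3,2,2,2,1,2, 3,3,2,2,2,1,2, 3,3,2,2,2,1,2]"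

text \<open>Letter number 15 of both words is the centre \<open>3\<^sup>*\<close>. The additional last letter breaks the
  period: a further period would start with 3.\<close>

definition central_word :: "int list" where
  "central_word = periodic_word @ [2]"

text \<open>A centre 1 or 2 gives too small a value. Around a centre 3, a neighbour 1 or two
  neighbours 2 give too large a value, and two neighbours 3 too small a one.\<close>

lemma check_start: "check True [(1, [3, 3, 2]), (1, [2, 3, 3])]
    (ExtR (Small 0 1) (Small 0 1) (ExtL (Big 1 1 1) (ExtR (Big 1 0 2) (Big 1 1 2) Hit) (ExtR (Big 1 0
     2) Hit (Small 1 2)))) 0 []"
  by code_simp

text \<open>Local uniqueness: any extension of \<open>3 3* 2\<close> deviating from
  \<open>central_word\<close> makes some value at least \<open>gap_hi\<close> or the centre value at
  most \<open>gap_lo\<close>.\<close>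

lemma check_central: "check True [(15, central_word)]
    (ExtR (Small 1 3) (ExtL (Big 1 1 1) (ExtR (ExtL (Big 3 3 4) (Big 3 3 4) (Big 2 2 3)) (ExtL (ExtL
     (ExtR (Small 4 5) (ExtL (ExtL (ExtR (Big 6 5 6) (Big 6 5 6) (ExtL (Big 7 7 5) (ExtL (ExtR (Big
     13 0 2) (Big 13 1 2) (Big 8 7 7)) (ExtR (Big 13 0 2) (Big 13 1 2) (Big 8 7 7)) (Big 8 8 5)) (Big
     0 0 2))) (Big 6 6 5) (Big 0 0 2)) (ExtR (ExtL (ExtR (Small 6 7) (Small 6 7) (Big 12 1 1)) (ExtR
     (Small 6 7) (ExtL (Big 7 7 7) (Big 7 7 7) (ExtR (Big 7 6 8) (ExtR (ExtL (Big 1 1 1) (Big 1 1 2)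
     (Big 8 8 8)) (Big 7 6 9) (Big 7 6 9)) (Small 7 8))) (Big 12 1 1)) (ExtR (ExtR (ExtL (Big 1 1 1)
     (Big 1 1 2) (ExtR (Small 7 9) (ExtR (Big 7 6 10) (Big 7 6 10) (ExtL (Big 1 1 1) (Big 8 8 9) (Big
     8 8 9))) (Big 15 1 1))) (Small 5 8) (Big 13 1 1)) (Big 6 6 7) (Big 12 1 1))) (Small 5 6) (Small
     5 6)) (Big 0 0 2)) (ExtL (Big 5 5 5) (Big 5 5 5) (Big 0 0 2))) (ExtR (ExtR (Big 4 4 6) (ExtL
     (ExtL (ExtR (ExtL (Big 7 7 6) (Big 7 7 6) (Big 0 0 2)) (Big 6 5 7) (Big 6 5 7)) (Big 6 6 6) (Big
     0 0 2)) (ExtR (Small 5 7) (ExtL (Small 6 6) (Small 6 7) (ExtR (ExtL (Big 1 1 1) (Big 1 1 2)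
     (ExtR (Small 7 9) (ExtR (ExtL (Big 1 1 1) (Big 2 2 5) (Big 2 2 3)) (Small 7 10) (Small 7 10))
     (Big 15 1 1))) (Small 5 8) (Small 5 8))) (ExtL (Small 6 6) (ExtL (Big 7 7 7) (Big 7 7 7) (ExtR
     (Big 13 0 2) (Big 13 1 2) (ExtL (Big 1 1 1) (Big 1 1 2) (ExtR (Big 15 0 2) (ExtR (Big 8 8 10)
     (ExtL (Big 1 1 1) (ExtR (Big 16 3 4) (ExtL (ExtL (ExtR (Big 11 11 12) (Big 18 4 5) (Big 18 4 5))
     (ExtR (ExtR (Big 18 4 6) (ExtL (Big 5 5 7) (ExtR (Big 12 12 14) (ExtL (Big 13 13 14) (ExtR (ExtL
     (Big 7 7 7) (Big 7 7 7) (ExtR (Big 14 14 16) (ExtL (Big 1 1 1) (Big 1 1 2) Hit) (Big 29 1 1)))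
     (Big 13 13 15) (Big 13 13 15)) (Big 6 6 7)) (ExtL (ExtL (ExtL (ExtR (Big 28 0 2) (Big 28 1 2)
     (Big 15 15 15)) (ExtR (Big 28 0 2) (Big 28 1 2) (ExtL (ExtR (Big 30 0 2) (Big 16 15 16) (Big 23
     8 9)) (Big 16 16 15) (Big 16 16 15))) (Big 0 0 2)) (Big 14 14 13) (Big 0 0 2)) (Small 13 14)
     (Big 6 6 7))) (Big 12 12 13)) (Big 23 1 1)) (Big 18 4 5) (Big 18 4 5)) (Big 0 0 2)) (Big 10 10
     11) (Big 2 2 3)) (Big 9 9 11)) (Big 2 2 3)) (Big 15 2 3)) (Big 8 8 9))))) (Big 6 6 7))) (Small 5
     6)) (Big 9 1 1)) (Big 4 4 5) (Big 4 4 5)) (Big 0 0 2)) (Small 3 4) (Big 2 2 3)) (Small 2 4))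
     (Big 2 2 3)) (ExtL (Big 1 1 1) (Big 2 2 3) (Big 2 2 3))) 1 [3, 3, 2]"
  by code_simp

text \<open>Self-replication: seven further letters on the left are forced, and 22 = 15 + 7. Only
  the upper bound \<open>gap_hi\<close> enters (\<open>sm\<close> is \<open>False\<close>), so the
  step can be iterated at shifted centres, where no lower bound is known.\<close>

lemma check_shift: "check False [(22, periodic_word)]
    (ExtL (Big 1 1 1) (ExtL (ExtL (Big 11 11 12) (ExtL (Big 5 5 7) (ExtL (ExtL (ExtL (Big 15 15 15)
     (Big 15 15 16) (Big 0 0 2)) (Big 14 14 13) (Big 0 0 2)) (ExtL (Big 7 7 7) (Big 7 7 7) (ExtL (Big
     1 1 1) (Big 1 1 2) Hit)) (Big 6 6 7)) (Big 12 12 13)) (Big 0 0 2)) (Big 10 10 11) (Big 2 2 3))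
     (Big 2 2 3)) 15 periodic_word"
  by code_simp

context low_window
begin

lemma central_if_332:
  assumes "gap_lo < R n + 1 / L (n - 1)" "occ b (n - 1) [3, 3, 2]"
    "lo + 50 \<le> n" "n + 50 \<le> hi"
  shows "occ b (n - 15) central_word"
  using check_sound[OF check_central] assms by simp

lemma central:
  assumes "gap_lo < R n + 1 / L (n - 1)" "lo + 50 \<le> n" "n + 50 \<le> hi"
  shows "occ b (n - 15) central_word \<or> occ (\<lambda>i. b (- i)) (- n - 15) central_word"
proof -
  interpret refl: low_window "\<lambda>i. b (- i)" "\<lambda>i. L (- i)" "\<lambda>i. R (- i)" "- hi" "- lo"
    by (rule reflect_low)
  have "occ b (n - 1) [3, 3, 2] \<or> occ b (n - 1) [2, 3, 3]"
    using check_sound[OF check_start, of n] assms by auto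
  then show ?thesis
  proof
    assume "occ b (n - 1) [2, 3, 3]"
    from occ_rev[OF this] have "occ (\<lambda>i. b (- i)) (- n - 1) [3, 3, 2]" by (simp add: add.commute)
    moreover have "gap_lo < L (- (- n)) + 1 / R (- (- n - 1))"
      using assms reflect_lambda[of n] by (simp add: add.commute)
    ultimately show ?thesis using refl.central_if_332[of "- n"] assms by simp
  qed (use central_if_332 assms in blast)
qed

lemma periodic_shift:
  assumes "occ b (n - 15) periodic_word" "lo + 50 \<le> n - 7 * int k" "n + 50 \<le> hi"
  shows "occ b (n - 7 * int k - 15) periodic_word"
  using assms
proof (induction k)
  case (Suc k)
  then have "occ b (n - 7 * int k - int 15) periodic_word" by simp
  from check_sound[OF check_shift this] show ?case
    using Suc.prems by (simp add: periodic_word_def algebra_simps)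
qed simp

lemma central_unique:
  assumes "occ b (m - 15) central_word" "occ b (n - 15) central_word" "m + 7 \<le> n"
    "lo + 50 \<le> m" "n + 50 \<le> hi"
  shows False
proof -
  \<comment> \<open>From \<open>n\<close>, a shift by \<open>k + 1\<close> periods ends at
    \<open>m + r\<close>, less than one period right of \<open>m\<close>;
    \<open>m + 7 \<le> n\<close> makes \<open>k\<close> a natural number.\<close>
  define k where "k = nat ((n - m) div 7 - 1)"
  define r where "r = (n - m) mod 7"
  have k: "n = m + r + 7 * int (Suc k)" and r: "0 \<le> r" "r < 7"
    using assms(3) by (auto simp: k_def r_def minus_mod_eq_mult_div[symmetric])
  have per: "occ b (n - 15) periodic_word" using assms(2) by (simp add: central_word_def)
  have 1: "occ b (m + r - 15) periodic_word"
    using periodic_shift[OF per, of "Suc k"] assms k r by (simp add: algebra_simps)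
  have 2: "occ b (m + r + 7 - 15) periodic_word"
    using periodic_shift[OF per, of k] assms k r by (simp add: algebra_simps)
  \<comment> \<open>The pair 33 at \<open>m - 1\<close> and \<open>m\<close> fits the period only
    for \<open>r = 0\<close>. Then the period puts 3 at \<open>m + 13\<close>, the place of the last
    letter 2 of \<open>central_word\<close>.\<close>
  have m: "b (m - 1) = 3" "b m = 3" "b (m + 13) = 2"
    using assms(1) by (auto simp: central_word_def periodic_word_def algebra_simps)
  have "r \<in> {0, 1, 2, 3, 4, 5, 6}" using r by auto
  then show False
    using 1 2 m by (auto simp: periodic_word_def algebra_simps)
qed

end

section \<open>The gap in the Lagrange spectrum\<close>

text \<open>The margin 3 is the look-ahead of \<open>quotient_bounds\<close>, applied in both
  directions.\<close>

lemma cf_window_of_digits: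
  fixes a :: "int \<Rightarrow> nat"
  assumes pos: "\<forall>n. a n > 0" and small: "\<And>i. lo - 3 \<le> i \<Longrightarrow> i \<le> hi + 3 \<Longrightarrow> a i \<le> 3"
  shows "cf_window (\<lambda>i. int (a i)) (rcf a) (lcf a) lo hi"
proof
  have ge1: "a n \<ge> 1" for n using pos by (simp add: Suc_leI)
  fix i assume i: "lo \<le> i" "i \<le> hi"
  show "int (a i) \<in> {1, 2, 3}" using ge1[of i] small[of i] i by auto
  show "rcf a i = real_of_int (int (a i)) + 1 / rcf a (i + 1)" using rcf_rec[OF pos, of i] by simp
  show "lcf a i = real_of_int (int (a i)) + 1 / lcf a (i - 1)" using lcf_rec[OF pos, of i] by simp
  have ge: "rcf a n \<ge> 1" "lcf a n \<ge> 1" for n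
    using rcf_ge[OF pos, of n] lcf_ge[OF pos, of n] ge1[of n] by linarith+
  have digits: "1 \<le> real (a (i + int k)) \<and> real (a (i + int k)) \<le> 3"
    "1 \<le> real (a (i - int k)) \<and> real (a (i - int k)) \<le> 3" if "k \<le> 3" for k
    using ge1[of "i + int k"] ge1[of "i - int k"] small[of "i + int k"] small[of "i - int k"] i that
    by auto
  have "rcf a (i + int k) = real (a (i + int k)) + 1 / rcf a (i + int (Suc k))" for k
    using rcf_rec[OF pos, of "i + int k"] by (simp add: algebra_simps)
  from quotient_bounds[of "\<lambda>k. rcf a (i + int k)", OF this ge(1) digits(1)]
  show "63 / 50 \<le> rcf a i \<and> rcf a i \<le> 19 / 5" by simp
  have "lcf a (i - int k) = real (a (i - int k)) + 1 / lcf a (i - int (Suc k))" for k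
    using lcf_rec[OF pos, of "i - int k"] by (simp add: algebra_simps)
  from quotient_bounds[of "\<lambda>k. lcf a (i - int k)", OF this ge(2) digits(2)]
  show "63 / 50 \<le> lcf a i \<and> lcf a i \<le> 19 / 5" by simp
qed

lemma lagrange_value_avoids_gap:
  assumes pos: "\<forall>n. a n > 0" and val: "lagrange_value a = ereal c"
    and gap: "gap_lo < c" "c < gap_hi"
  shows False
proof -
  have "\<forall>\<^sub>F n in sequentially. ereal (markov_lambda a (int n)) < ereal gap_hi"
    using val gap(2) by (intro Limsup_lessD) (simp add: lagrange_value_def)
  then obtain N :: nat where
    N: "\<And>n. n \<ge> N \<Longrightarrow> markov_lambda a (int n) < gap_hi"
    by (auto simp: eventually_sequentially)
  have small: "a i \<le> 3" if "i \<ge> int N" for i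
  proof -
    have "real (a i) < 4"
      using digit_less_markov_lambda[OF pos, of i] N[of "nat i"] that by (simp add: le_nat_iff)
    then show ?thesis by linarith
  qed
  have freq: "\<exists>n\<ge>m. gap_lo < markov_lambda a (int n)" for m :: nat
  proof (rule ccontr)
    assume "\<not> ?thesis"
    then have "\<forall>\<^sub>F n in sequentially. ereal (markov_lambda a (int n)) \<le> ereal gap_lo"
      by (auto simp: eventually_sequentially not_less)
    then have "lagrange_value a \<le> ereal gap_lo"
      unfolding lagrange_value_def by (rule Limsup_bounded)
    with val gap(1) show False by simp
  qed
  \<comment> \<open>Three far out positions at least 7 apart: two of them carry the central word in
    the same orientation, which \<open>central_unique\<close> forbids.\<close>
  obtain x where x: "x \<ge> N + 60" "gap_lo < markov_lambda a (int x)"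
    using freq by blast
  obtain y where y: "y \<ge> x + 7" "gap_lo < markov_lambda a (int y)"
    using freq by blast
  obtain z where z: "z \<ge> y + 7" "gap_lo < markov_lambda a (int z)"
    using freq by blast
  interpret cf_window "\<lambda>i. int (a i)" "rcf a" "lcf a" "int N + 3" "int z + 50"
    by (rule cf_window_of_digits[OF pos]) (simp add: small)
  interpret low_window "\<lambda>i. int (a i)" "rcf a" "lcf a" "int N + 3" "int z + 50"
  proof
    fix i assume "int N + 3 < i" "i < int z + 50"
    then show "rcf a i + 1 / lcf a (i - 1) < gap_hi"
      using N[of "nat i"] by (simp add: markov_lambda_eq[OF pos])
  qed
  interpret refl: low_window "\<lambda>i. int (a (- i))" "\<lambda>i. lcf a (- i)" "\<lambda>i. rcf a (- i)"
    "- (int z + 50)" "- (int N + 3)"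
    by (rule reflect_low)
  define P where "P n \<longleftrightarrow> occ (\<lambda>i. int (a i)) (int n - 15) central_word" for n :: nat
  define Q where "Q n \<longleftrightarrow> occ (\<lambda>i. int (a (- i))) (- int n - 15) central_word" for n :: nat
  have PQ: "P n \<or> Q n"
    if "n \<ge> x" "n \<le> z" "gap_lo < markov_lambda a (int n)" for n
    using central[of "int n"] that x(1) by (simp add: P_def Q_def markov_lambda_eq[OF pos])
  have P: "\<not> (P m \<and> P n)" if "m \<ge> x" "m + 7 \<le> n" "n \<le> z" for m n
    using central_unique[of "int m" "int n"] that x(1) by (auto simp: P_def)
  have Q: "\<not> (Q m \<and> Q n)" if "m \<ge> x" "m + 7 \<le> n" "n \<le> z" for m n
    using refl.central_unique[of "- int n" "- int m"] that x(1) by (auto simp: Q_def)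
  have "P x \<or> Q x" "P y \<or> Q y" "P z \<or> Q z" using PQ x y z by auto
  moreover have "\<not> (P x \<and> P y)" "\<not> (P y \<and> P z)" "\<not> (P x \<and> P z)"
    using P[of x y] P[of y z] P[of x z] y(1) z(1) by auto
  moreover have "\<not> (Q x \<and> Q y)" "\<not> (Q y \<and> Q z)" "\<not> (Q x \<and> Q z)"
    using Q[of x y] Q[of y z] Q[of x z] y(1) z(1) by auto
  ultimately show False by blast
qed

section \<open>The sequences \<open>a(\<theta>)\<close>\<close>

context
  fixes \<theta> :: "nat \<Rightarrow> nat"
  assumes theta: "\<forall>k\<ge>1. \<theta> k \<in> {1, 2}"
begin

lemma a_seq_left:
  assumes "n \<le> - 2"
  shows "a_seq \<theta> n = (if n mod 7 \<in> {0, 6} then 3 else if n mod 7 = 4 then 1 else 2)"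
proof -
  have "0 \<le> (n + 8) mod 7" "(n + 8) mod 7 < 7" by auto
  then have "(n + 8) mod 7 \<in> {0, 1, 2, 3, 4, 5, 6}" by auto
  moreover have "n mod 7 = ((n + 8) mod 7 + 6) mod 7" by presburger
  ultimately show ?thesis using assms by (auto simp: a_seq_def)
qed

lemma middle_cases:
  fixes n :: int
  assumes "- 1 \<le> n" "n \<le> 19"
  shows "n = - 1 \<or> n = 0 \<or> n = 1 \<or> n = 2 \<or> n = 3 \<or> n = 4 \<or> n = 5 \<or> n = 6 \<or> n = 7 \<or> n = 8 \<or>
    n = 9 \<or> n = 10 \<or> n = 11 \<or> n = 12 \<or> n = 13 \<or> n = 14 \<or> n = 15 \<or> n = 16 \<or> n = 17 \<or> n = 18 \<or>
    n = 19"
  using assms by presburger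

lemma a_seq_middle:
  assumes "- 1 \<le> n" "n \<le> 19"
  shows "a_seq \<theta> n = [3, 3, 2, 2, 2, 1, 2, 3, 3, 2, 2, 2, 1, 2, 2, 1, 2, 1, 2, 1, 2] ! nat (n + 1)"
proof -
  note middle_cases[OF assms]
  then show ?thesis by (elim disjE) (simp_all add: a_seq_def)
qed

lemma a_seq_right: "n \<ge> 20 \<Longrightarrow> a_seq \<theta> n \<in> {1, 2}"
  using theta[rule_format, of "nat (n - 19)"] by (simp add: a_seq_def)

lemma a_seq_digits: "a_seq \<theta> n \<in> {1, 2, 3}"
  and a_seq_eq_3: "a_seq \<theta> n = 3 \<Longrightarrow> n \<in> {- 1, 0, 6, 7} \<or> n \<le> - 2 \<and> n mod 7 \<in> {0, 6}"
proof -
  consider "n \<le> - 2" | "- 1 \<le> n" "n \<le> 19" | "n \<ge> 20" by linarith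
  then have "a_seq \<theta> n \<in> {1, 2, 3} \<and>
      (a_seq \<theta> n = 3 \<longrightarrow> n \<in> {- 1, 0, 6, 7} \<or> n \<le> - 2 \<and> n mod 7 \<in> {0, 6})"
  proof cases
    case 1
    then show ?thesis by (auto simp: a_seq_left)
  next
    case 2
    note middle_cases[OF 2]
    then show ?thesis by (elim disjE) (simp_all add: a_seq_middle)
  next
    case 3
    then show ?thesis using a_seq_right[of n] by auto
  qed
  then show "a_seq \<theta> n \<in> {1, 2, 3}"
    "a_seq \<theta> n = 3 \<Longrightarrow> n \<in> {- 1, 0, 6, 7} \<or> n \<le> - 2 \<and> n mod 7 \<in> {0, 6}" by auto
qed

lemma a_seq_pos: "\<forall>n. a_seq \<theta> n > 0"
proof
  show "a_seq \<theta> n > 0" for n using a_seq_digits[of n] by auto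
qed

lemma a_seq_window: "cf_window (\<lambda>i. int (a_seq \<theta> i)) (rcf (a_seq \<theta>)) (lcf (a_seq \<theta>)) lo hi"
proof (rule cf_window_of_digits[OF a_seq_pos])
  show "a_seq \<theta> i \<le> 3" for i using a_seq_digits[of i] by auto
qed

section \<open>Estimates of the values of a(\<theta>)\<close>

lemma a_seq_lambda_ge:
  assumes "occ (\<lambda>i. int (a_seq \<theta> i)) p w" "i < length w" "d > 0"
    "lambda_ge n d (rev (take i w)) (drop i w)"
  shows "n / d \<le> markov_lambda (a_seq \<theta>) (p + int i)"
proof -
  interpret cf_window "\<lambda>i. int (a_seq \<theta> i)" "rcf (a_seq \<theta>)" "lcf (a_seq \<theta>)" "p - 1" "p + int (length w)"
    by (rule a_seq_window)
  show ?thesis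
    using lambda_geD[OF assms(1), of i n d "length w" "length w"] assms
    by (simp add: markov_lambda_eq[OF a_seq_pos])
qed

lemma a_seq_lambda_le:
  assumes "occ (\<lambda>i. int (a_seq \<theta> i)) p w" "i < length w" "d > 0"
    "lambda_le n d (rev (take i w)) (drop i w)"
  shows "markov_lambda (a_seq \<theta>) (p + int i) \<le> n / d"
proof -
  interpret cf_window "\<lambda>i. int (a_seq \<theta> i)" "rcf (a_seq \<theta>)" "lcf (a_seq \<theta>)" "p - 1" "p + int (length w)"
    by (rule a_seq_window)
  show ?thesis
    using lambda_leD[OF assms(1), of i n d "length w" "length w"] assms
    by (simp add: markov_lambda_eq[OF a_seq_pos])
qed

text \<open>The letters from -22 to 19, just before \<theta> begins, so bounds read off from it hold
  for all \<theta>. Letter number 22 is \<open>a\<^sub>0\<close>.\<close>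

definition middle_word :: "int list" where
  "middle_word = [3,3,2,2,2,1,2, 3,3,2,2,2,1,2, 3,3,2,2,2,1,2, 3,3,2,2,2,1,2,3,3,2,2,2,1,2,2,1,2,1,2,1,2]"

lemma occ_middle: "occ (\<lambda>i. int (a_seq \<theta> i)) (- 22) middle_word"
  by (simp add: middle_word_def a_seq_left a_seq_middle)

lemma lambda_0_bounds:
  "37096998597501 / 10000000000000 \<le> markov_lambda (a_seq \<theta>) 0"
  "markov_lambda (a_seq \<theta>) 0 \<le> 370969985975029 / 100000000000000"
proof -
  have "lambda_ge 37096998597501 10000000000000 (rev (take 22 middle_word)) (drop 22 middle_word)"
    unfolding middle_word_def by code_simp
  from a_seq_lambda_ge[OF occ_middle _ _ this]
  show "37096998597501 / 10000000000000 \<le> markov_lambda (a_seq \<theta>) 0"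
    by (simp add: middle_word_def)
  have "lambda_le 370969985975029 100000000000000 (rev (take 22 middle_word)) (drop 22 middle_word)"
    unfolding middle_word_def by code_simp
  from a_seq_lambda_le[OF occ_middle _ _ this]
  show "markov_lambda (a_seq \<theta>) 0 \<le> 370969985975029 / 100000000000000"
    by (simp add: middle_word_def)
qed

lemma lambda_le_middle:
  assumes "n \<in> {- 1, 6, 7}"
  shows "markov_lambda (a_seq \<theta>) n \<le> gap_lo"
proof -
  have "lambda_le 370969985975 100000000000 (rev (take 21 middle_word)) (drop 21 middle_word)"
    "lambda_le 370969985975 100000000000 (rev (take 28 middle_word)) (drop 28 middle_word)"
    "lambda_le 370969985975 100000000000 (rev (take 29 middle_word)) (drop 29 middle_word)"
    unfolding middle_word_def by code_simp+
  from this[THEN a_seq_lambda_le[OF occ_middle, rotated 2]] show ?thesis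
    using assms by (auto simp: middle_word_def)
qed

text \<open>The left period continues through position 12; at 13 stands 2 instead of 3.\<close>

lemma a_seq_period:
  assumes "n \<le> 12"
  shows "a_seq \<theta> (n - 7 * int j) = a_seq \<theta> n"
proof (induction j)
  case (Suc j)
  have step: "a_seq \<theta> (m - 7) = a_seq \<theta> m" if "m \<le> 12" for m
  proof (cases "m \<le> - 2")
    case True
    then show ?thesis by (simp add: a_seq_left)
  next
    case False
    then have "- 1 \<le> m" "m \<le> 19" using that by simp_all
    from middle_cases[OF this] that show ?thesis
      by (elim disjE) (simp_all add: a_seq_left a_seq_middle)
  qed
  have "a_seq \<theta> (n - 7 * int (Suc j)) = a_seq \<theta> (n - 7 * int j - 7)"
    by (simp add: algebra_simps)
  also have "\<dots> = a_seq \<theta> (n - 7 * int j)" by (rule step) (use assms in simp)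
  finally show ?case using Suc.IH by simp
qed simp

text \<open>By periodicity all these positions see letter 14 or 15 of the same word. It differs from
  \<open>central_word\<close> only in its last letter, and this keeps the values at most
  \<open>gap_lo\<close>.\<close>

lemma lambda_le_left:
  assumes "n \<le> - 2" "n mod 7 \<in> {0, 6}"
  shows "markov_lambda (a_seq \<theta>) n \<le> gap_lo"
proof -
  obtain j where j: "n = - 7 - 7 * int j \<or> n = - 8 - 7 * int j"
  proof
    let ?k = "(n + 1) div 7"
    have "n = 7 * ?k \<or> n = 7 * ?k - 1" "?k \<le> - 1" using assms by (auto; presburger)+
    then show "n = - 7 - 7 * int (nat (- 1 - ?k)) \<or> n = - 8 - 7 * int (nat (- 1 - ?k))" by auto
  qed
  have "occ (\<lambda>i. int (a_seq \<theta> i)) (- 22) (periodic_word @ [3])"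
    by (simp add: periodic_word_def a_seq_left a_seq_middle)
  then have "int (a_seq \<theta> (- 22 + int t - 7 * int j)) = (periodic_word @ [3]) ! t"
    if "t < length (periodic_word @ [3])" for t
    using a_seq_period[of "- 22 + int t"] that by (simp add: occ_def periodic_word_def)
  then have "occ (\<lambda>i. int (a_seq \<theta> i)) (- 22 - 7 * int j) (periodic_word @ [3])"
    unfolding occ_def by (simp add: algebra_simps)
  note le = a_seq_lambda_le[OF this]
  have "lambda_le 370969985975 100000000000
      (rev (take 14 (periodic_word @ [3]))) (drop 14 (periodic_word @ [3]))"
    "lambda_le 370969985975 100000000000
      (rev (take 15 (periodic_word @ [3]))) (drop 15 (periodic_word @ [3]))"
    unfolding periodic_word_def by code_simp+
  from this[THEN le[rotated 2]] show ?thesis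
    using j by (auto simp: periodic_word_def)
qed

text \<open>Both tails are at least 63/50, so the value is at most 2 + 100/63, below
  \<open>gap_lo\<close>.\<close>

lemma lambda_le_small_digit:
  assumes "a_seq \<theta> n \<le> 2"
  shows "markov_lambda (a_seq \<theta>) n \<le> gap_lo"
proof -
  define x where "x = int (a_seq \<theta> n)"
  have x: "x = 1 \<or> x = 2"
    using assms a_seq_digits[of n] unfolding x_def by auto
  have "occ (\<lambda>i. int (a_seq \<theta> i)) n [x]" by (simp add: x_def)
  moreover have "lambda_le 370969985975 100000000000 (rev (take 0 [x])) (drop 0 [x])"
    using x by (elim disjE) (simp_all add: lambda_le_def)
  ultimately show ?thesis
    using a_seq_lambda_le[of n "[x]" 0 100000000000 370969985975] by simp
qed

lemma markov_value_a_seq: "markov_value (a_seq \<theta>) = ereal (markov_lambda (a_seq \<theta>) 0)"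
  unfolding markov_value_def
proof (rule antisym)
  show "(SUP n. ereal (markov_lambda (a_seq \<theta>) n)) \<le> ereal (markov_lambda (a_seq \<theta>) 0)"
  proof (rule SUP_least)
    fix n
    show "ereal (markov_lambda (a_seq \<theta>) n) \<le> ereal (markov_lambda (a_seq \<theta>) 0)"
    proof (cases "n = 0")
      case False
      have "markov_lambda (a_seq \<theta>) n \<le> gap_lo"
      proof (cases "a_seq \<theta> n = 3")
        case True
        from a_seq_eq_3[OF this] \<open>n \<noteq> 0\<close>
        have "n \<in> {- 1, 6, 7} \<or> n \<le> - 2 \<and> n mod 7 \<in> {0, 6}" by blast
        then show ?thesis
          by (elim disjE conjE) (rule lambda_le_middle lambda_le_left; assumption)+
      next
        case False
        then have "a_seq \<theta> n \<le> 2" using a_seq_digits[of n] by force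
        then show ?thesis by (rule lambda_le_small_digit)
      qed
      then show ?thesis using lambda_0_bounds(1) by simp
    qed simp
  qed
qed (rule SUP_upper, simp)

end

theorem theorem5p3:
  shows "C_set \<subseteq> markov_spectrum - lagrange_spectrum"
proof
  fix x assume "x \<in> C_set"
  then obtain \<theta> where theta: "\<forall>k\<ge>1. \<theta> k \<in> {1, 2}" and x: "x = markov_lambda (a_seq \<theta>) 0"
    by (auto simp: C_set_def)
  have "x \<in> markov_spectrum"
    using a_seq_pos[OF theta] markov_value_a_seq[OF theta] by (auto simp: markov_spectrum_def x)
  moreover have "x \<notin> lagrange_spectrum"
  proof
    assume "x \<in> lagrange_spectrum"
    then obtain a where a: "\<forall>n. a n > 0" "lagrange_value a = ereal x"
      by (auto simp: lagrange_spectrum_def)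
    show False
      using lagrange_value_avoids_gap[OF a] lambda_0_bounds[OF theta] by (simp add: x)
  qed
  ultimately show "x \<in> markov_spectrum - lagrange_spectrum" by simp
qed

end
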